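(* Let $(\Omega,\mathcal{F},\mu)$ be a probability space and let $\mathcal{F}_1,\dots,\mathcal{F}_n$ be sub-$\sigma$-algebras of $\mathcal{F}$. The collection of sub-$\sigma$-algebras $\mathcal{F}_1,\dots,\mathcal{F}_n$ possesses the IMP if and only if the system of subspaces $L^2_0(\mathcal{F}_1),\dots,L^2_0(\mathcal{F}_n)$ possesses the IBAP (in $L^2(\mathcal{F})$).
   Context: Random variables take values in a fixed base field $\mathbb{K}$, $\mathbb{K}=\mathbb{R}$ or $\mathbb{C}$; $E$ denotes expectation. $L^2(\mathcal{F})=L^2(\Omega,\mathcal{F},\mu)$ is the Hilbert space of ($\mu$-a.e. equivalence classes of) random variables $\xi:\Omega\to\mathbb{K}$ with $E|\xi|^2<\infty$ and inner product $\langle\xi,\eta\rangle=E(\xi\overline{\eta})$. For a sub-$\sigma$-algebra $\mathcal{A}\subset\mathcal{F}$, the marginal subspace $L^2(\mathcal{A})$ is the closed subspace of $L^2(\mathcal{F})$ of those classes that contain at least one $\mathcal{A}$-measurable random variable, and $L^2_0(\mathcal{A}):=\{\xi\in L^2(\mathcal{A})\mid E\xi=0\}$ (also closed). The collection $\mathcal{F}_1,\dots,\mathcal{F}_n$ possesses the inverse marginal property (IMP) if for arbitrary random variables $\xi_1,\dots,\xi_n$ such that $\xi_k$ is $\mathcal{F}_k$-measurable and $E|\xi_k|^2<\infty$ for $k=1,\dots,n$, and $E\xi_1=E\xi_2=\dots=E\xi_n$, there exists a random variable $\xi$ with $E|\xi|^2<\infty$ and $E(\xi|\mathcal{F}_k)=\xi_k$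 (a.s.) for all $k=1,\dots,n$. A system of closed subspaces $H_1,\dots,H_n$ of a Hilbert space $H$, with $P_k$ the orthogonal projection onto $H_k$, possesses the inverse best approximation property (IBAP) if for arbitrary $x_1\in H_1,\dots,x_n\in H_n$ there exists $x\in H$ such that $P_kx=x_k$ for all $k=1,\dots,n$. *)

theory Defs
  imports "HOL-Probability.Probability"
begin

section \<open>The base field\<close>

text \<open>
  A common interface to the two base fields, real and complex, so that every notion below is
  defined once. The statement itself is made for the two instances explicitly.
\<close>

class base_field = real_normed_field + euclidean_space +
  fixes conjugate :: "'a \<Rightarrow> 'a"
  assumes conjugate_add: "conjugate (x + y) = conjugate x + conjugate y"
    and conjugate_mult: "conjugate (x * y) = conjugate x * conjugate y"
    and conjugate_conjugate: "conjugate (conjugate x) = x"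
    and conjugate_scaleR: "conjugate (r *\<^sub>R x) = r *\<^sub>R conjugate x"
    and mult_conjugate_self: "x * conjugate x = (norm x)\<^sup>2 *\<^sub>R 1"

instantiation real :: base_field
begin

definition conjugate_real :: "real \<Rightarrow> real" where
  "conjugate_real x = x"

instance
  by standard (simp_all add: conjugate_real_def power2_eq_square)

end

instantiation complex :: base_field
begin

definition conjugate_complex :: "complex \<Rightarrow> complex" where
  "conjugate_complex z = cnj z"

instance
  by standard (simp_all add: conjugate_complex_def scaleR_conv_of_real flip: complex_norm_square)

end

section \<open>Orthogonal projections and the inverse best approximation property\<close>

text \<open>
  The space of square-integrable classes depends on the measure, so it is not a type;
  Hilbert spaces are therefore structures with an explicit carrier.
\<close>

record ('h, 'k) inner_space =
  vecs :: "'h set"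
  vadd :: "'h \<Rightarrow> 'h \<Rightarrow> 'h"
  vscale :: "'k \<Rightarrow> 'h \<Rightarrow> 'h"
  vinner :: "'h \<Rightarrow> 'h \<Rightarrow> 'k"

definition vdiff :: "('h, 'k::base_field) inner_space \<Rightarrow> 'h \<Rightarrow> 'h \<Rightarrow> 'h" where
  "vdiff H x y = vadd H x (vscale H (- 1) y)"

text \<open>\<open>proj\<close> is meaningful when \<open>S\<close> is a closed subspace of a Hilbert space \<open>H\<close>.\<close>

definition proj :: "('h, 'k::base_field) inner_space \<Rightarrow> 'h set \<Rightarrow> 'h \<Rightarrow> 'h" where
  "proj H S x = (THE y. y \<in> S \<and> (\<forall>z\<in>S. vinner H (vdiff H x y) z = 0))"

definition IBAP :: "('h, 'k::base_field) inner_space \<Rightarrow> (nat \<Rightarrow> 'h set) \<Rightarrow> nat \<Rightarrow> bool" where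
  "IBAP H S n \<longleftrightarrow>
     (\<forall>x. (\<forall>k\<in>{1..n}. x k \<in> S k) \<longrightarrow> (\<exists>y\<in>vecs H. \<forall>k\<in>{1..n}. proj H (S k) y = x k))"

section \<open>Square-integrable random variables\<close>

definition sq_int :: "'a measure \<Rightarrow> ('a \<Rightarrow> 'k::base_field) set" where
  "sq_int M = {f \<in> borel_measurable M. integrable M (\<lambda>\<omega>. (norm (f \<omega>))\<^sup>2)}"

definition ae_rel :: "'a measure \<Rightarrow> (('a \<Rightarrow> 'k::base_field) \<times> ('a \<Rightarrow> 'k)) set" where
  "ae_rel M = {(f, g). f \<in> sq_int M \<and> g \<in> sq_int M \<and> (AE \<omega> in M. f \<omega> = g \<omega>)}"

definition ae_class :: "'a measure \<Rightarrow> ('a \<Rightarrow> 'k::base_field) \<Rightarrow> ('a \<Rightarrow> 'k) set" where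
  "ae_class M f = ae_rel M `` {f}"

definition rep :: "('a \<Rightarrow> 'k) set \<Rightarrow> 'a \<Rightarrow> 'k" where
  "rep X = (SOME f. f \<in> X)"

definition L2 :: "'a measure \<Rightarrow> (('a \<Rightarrow> 'k::base_field) set, 'k) inner_space" where
  "L2 M = \<lparr>vecs = sq_int M // ae_rel M,
           vadd = (\<lambda>X Y. ae_class M (\<lambda>\<omega>. rep X \<omega> + rep Y \<omega>)),
           vscale = (\<lambda>c X. ae_class M (\<lambda>\<omega>. c * rep X \<omega>)),
           vinner = (\<lambda>X Y. \<integral>\<omega>. rep X \<omega> * conjugate (rep Y \<omega>) \<partial>M)\<rparr>"

text \<open>Sub-sigma-algebras are given as measures \<open>A\<close> with \<open>subalgebra M A\<close>; only \<open>sets A\<close> matters.\<close>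

definition L2_sub :: "'a measure \<Rightarrow> 'a measure \<Rightarrow> ('a \<Rightarrow> 'k::base_field) set set" where
  "L2_sub M A = {X \<in> vecs (L2 M). \<exists>f\<in>X. f \<in> borel_measurable A}"

definition L2_0 :: "'a measure \<Rightarrow> 'a measure \<Rightarrow> ('a \<Rightarrow> 'k::base_field) set set" where
  "L2_0 M A = {X \<in> L2_sub M A. (\<integral>\<omega>. rep X \<omega> \<partial>M) = 0}"

section \<open>The inverse marginal property\<close>

text \<open>
  The library has conditional expectations of real random variables only; over the base field they
  are taken in each real coordinate (real and imaginary part).
\<close>

definition cond_exp :: "'a measure \<Rightarrow> 'a measure \<Rightarrow> ('a \<Rightarrow> 'k::base_field) \<Rightarrow> 'a \<Rightarrow> 'k" where
  "cond_exp M A f \<omega> = (\<Sum>b\<in>Basis. real_cond_exp M A (\<lambda>x. f x \<bullet> b) \<omega> *\<^sub>R b)"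

lemma cond_exp_real: "cond_exp M A f = real_cond_exp M A f" for f :: "'a \<Rightarrow> real"
  by (simp add: cond_exp_def fun_eq_iff)

lemma cond_exp_complex:
  "cond_exp M A f \<omega> =
     Complex (real_cond_exp M A (\<lambda>x. Re (f x)) \<omega>) (real_cond_exp M A (\<lambda>x. Im (f x)) \<omega>)"
  by (simp add: cond_exp_def Basis_complex_def complex_eq_iff)

text \<open>The type argument selects the field in which the random variables take their values.\<close>

definition IMP :: "'k::base_field itself \<Rightarrow> 'a measure \<Rightarrow> (nat \<Rightarrow> 'a measure) \<Rightarrow> nat \<Rightarrow> bool" where
  "IMP K M F n \<longleftrightarrow>
     (\<forall>\<xi> :: nat \<Rightarrow> 'a \<Rightarrow> 'k.
        (\<forall>k\<in>{1..n}. \<xi> k \<in> borel_measurable (F k) \<and> integrable M (\<lambda>\<omega>. (norm (\<xi> k \<omega>))\<^sup>2)) \<and>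
        (\<forall>j\<in>{1..n}. \<forall>k\<in>{1..n}. (\<integral>\<omega>. \<xi> j \<omega> \<partial>M) = (\<integral>\<omega>. \<xi> k \<omega> \<partial>M)) \<longrightarrow>
        (\<exists>\<eta> :: 'a \<Rightarrow> 'k. \<eta> \<in> borel_measurable M \<and> integrable M (\<lambda>\<omega>. (norm (\<eta> \<omega>))\<^sup>2) \<and>
           (\<forall>k\<in>{1..n}. AE \<omega> in M. cond_exp M (F k) \<eta> \<omega> = \<xi> k \<omega>)))"

section \<open>Independence of the chosen representatives\<close>

lemma equiv_ae_rel: "equiv (sq_int M) (ae_rel M)"
proof (rule equivI)
  show "ae_rel M \<subseteq> sq_int M \<times> sq_int M" by (auto simp: ae_rel_def)
  show "refl_on (sq_int M) (ae_rel M)" by (auto simp: refl_on_def ae_rel_def)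
  show "sym (ae_rel M)" by (auto simp: sym_def ae_rel_def elim: AE_mp)
  show "trans (ae_rel M)" by (auto simp: trans_def ae_rel_def elim: AE_mp)
qed

lemma mem_ae_class:
  "g \<in> ae_class M f \<longleftrightarrow> f \<in> sq_int M \<and> g \<in> sq_int M \<and> (AE \<omega> in M. f \<omega> = g \<omega>)"
  by (simp add: ae_class_def ae_rel_def)

lemma rep_ae_class:
  assumes "f \<in> sq_int M"
  shows "rep (ae_class M f) \<in> sq_int M" "AE \<omega> in M. rep (ae_class M f) \<omega> = f \<omega>"
proof -
  have "f \<in> ae_class M f"
    using assms by (simp add: mem_ae_class)
  then have "rep (ae_class M f) \<in> ae_class M f"
    unfolding rep_def by (rule someI[where P = "\<lambda>g. g \<in> ae_class M f"])
  then have "rep (ae_class M f) \<in> sq_int M \<and> (AE \<omega> in M. f \<omega> = rep (ae_class M f) \<omega>)"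
    by (simp only: mem_ae_class)
  then show "rep (ae_class M f) \<in> sq_int M" "AE \<omega> in M. rep (ae_class M f) \<omega> = f \<omega>"
    by (auto elim: AE_mp)
qed

lemma vecs_L2: "vecs (L2 M) = ae_class M ` sq_int M"
  by (auto simp: L2_def quotient_def ae_class_def)

lemma borel_measurable_conjugate: "conjugate \<in> borel_measurable (borel :: 'k::base_field measure)"
proof -
  have "linear (conjugate :: 'k \<Rightarrow> 'k)"
    by (intro linearI) (simp_all add: conjugate_add conjugate_scaleR)
  then show ?thesis
    by (intro borel_measurable_continuous_onI linear_continuous_on)
       (simp add: linear_conv_bounded_linear)
qed

lemma vinner_L2:
  fixes f g :: "'a \<Rightarrow> 'k::base_field"
  assumes "f \<in> sq_int M" "g \<in> sq_int M"
  shows "vinner (L2 M) (ae_class M f) (ae_class M g) = (\<integral>\<omega>. f \<omega> * conjugate (g \<omega>) \<partial>M)"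
proof -
  note [measurable] = borel_measurable_conjugate
  have [measurable]: "f \<in> borel_measurable M" "g \<in> borel_measurable M"
      "rep (ae_class M f) \<in> borel_measurable M" "rep (ae_class M g) \<in> borel_measurable M"
    using assms rep_ae_class(1)[OF assms(1)] rep_ae_class(1)[OF assms(2)]
    by (auto simp: sq_int_def)
  show ?thesis
    using rep_ae_class(2)[OF assms(1)] rep_ae_class(2)[OF assms(2)]
    by (auto simp: L2_def intro!: integral_cong_AE)
qed

lemma ae_class_eqI:
  assumes "f \<in> sq_int M" "g \<in> sq_int M" "AE \<omega> in M. f \<omega> = g \<omega>"
  shows "ae_class M f = ae_class M g"
  unfolding ae_class_def
  by (rule equiv_class_eq[OF equiv_ae_rel]) (use assms in \<open>simp add: ae_rel_def\<close>)

lemma sq_int_add: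
  fixes f g :: "'a \<Rightarrow> 'k::base_field"
  assumes "f \<in> sq_int M" "g \<in> sq_int M"
  shows "(\<lambda>\<omega>. f \<omega> + g \<omega>) \<in> sq_int M"
proof -
  have [measurable]: "f \<in> borel_measurable M" "g \<in> borel_measurable M"
    using assms by (auto simp: sq_int_def)
  have bound: "(norm (x + y))\<^sup>2 \<le> 2 * (norm x)\<^sup>2 + 2 * (norm y)\<^sup>2" for x y :: 'k
  proof -
    have "(norm (x + y))\<^sup>2 \<le> (norm x + norm y)\<^sup>2"
      by (intro power_mono norm_triangle_ineq) simp
    also have "\<dots> \<le> 2 * (norm x)\<^sup>2 + 2 * (norm y)\<^sup>2"
      using sum_squares_bound[of "norm x" "norm y"] by (simp add: power2_sum)
    finally show ?thesis .
  qed
  have "integrable M (\<lambda>\<omega>. 2 * (norm (f \<omega>))\<^sup>2 + 2 * (norm (g \<omega>))\<^sup>2)"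
    using assms by (auto simp: sq_int_def)
  then have "integrable M (\<lambda>\<omega>. (norm (f \<omega> + g \<omega>))\<^sup>2)"
    by (rule Bochner_Integration.integrable_bound) (auto intro!: AE_I2 simp: bound)
  then show ?thesis
    by (simp add: sq_int_def)
qed

lemma sq_int_mult_const:
  assumes "f \<in> sq_int M"
  shows "(\<lambda>\<omega>. c * f \<omega>) \<in> sq_int M"
  using assms by (auto simp: sq_int_def norm_mult power_mult_distrib)

lemma vadd_L2:
  assumes "f \<in> sq_int M" "g \<in> sq_int M"
  shows "vadd (L2 M) (ae_class M f) (ae_class M g) = ae_class M (\<lambda>\<omega>. f \<omega> + g \<omega>)"
  using assms rep_ae_class[OF assms(1)] rep_ae_class[OF assms(2)]
  unfolding L2_def inner_space.simps by (intro ae_class_eqI sq_int_add) (auto elim: AE_mp)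

lemma vscale_L2:
  assumes "f \<in> sq_int M"
  shows "vscale (L2 M) c (ae_class M f) = ae_class M (\<lambda>\<omega>. c * f \<omega>)"
  using assms rep_ae_class[OF assms]
  unfolding L2_def inner_space.simps by (intro ae_class_eqI sq_int_mult_const) (auto elim: AE_mp)

lemma integral_rep_ae_class:
  assumes "f \<in> sq_int M"
  shows "(\<integral>\<omega>. rep (ae_class M f) \<omega> \<partial>M) = (\<integral>\<omega>. f \<omega> \<partial>M)"
  using assms rep_ae_class[OF assms] by (intro integral_cong_AE) (auto simp: sq_int_def)

end

theory Submission imports Defs begin

text \<open>
  The two properties differ only by a normalisation of the mean. The orthogonal projection of the
  class of \<open>f\<close> onto the centred marginal space of a sub-sigma-algebra \<open>A\<close> is the class of the
  conditional expectation of \<open>f\<close> given \<open>A\<close>, minus the mean of \<open>f\<close>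
  (\<open>proj_L2_0\<close>). This holds because this random variable is square-integrable by
  Jensen's inequality, \<open>A\<close>-measurable and centred, because \<open>f\<close> minus its conditional expectation
  is orthogonal to every square-integrable \<open>A\<close>-measurable random variable, and because constants
  are orthogonal to centred random variables.

  Prescribing the projections of \<open>f\<close> therefore means prescribing its centred conditional
  expectations. If the IMP holds, centred data \<open>x\<^sub>1, \<dots>, x\<^sub>n\<close> are the conditional expectations of a
  random variable whose mean is their common mean 0, so its class projects onto them. If the IBAP
  holds and the data \<open>\<xi>\<^sub>1, \<dots>, \<xi>\<^sub>n\<close> have the common mean \<open>c\<close>, the random variable obtained for
  \<open>\<xi>\<^sub>1 - c, \<dots>, \<xi>\<^sub>n - c\<close> is shifted by a constant so that its mean becomes \<open>c\<close>; constants pass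
  through conditional expectations.

  The conditional expectation over the base field is defined coordinatewise. Its properties are
  reduced to the real ones by expanding vectors, and products of vectors, in the standard basis.
\<close>

section \<open>Square-integrable random variables\<close>

lemma norm_conjugate: "norm (conjugate x) = norm (x :: 'k::base_field)"
proof (cases "x = 0")
  case True
  then show ?thesis
    using conjugate_scaleR[of 0 x] by simp
next
  case False
  have "norm x * norm (conjugate x) = norm x * norm x"
    using arg_cong[OF mult_conjugate_self[of x], of norm]
    by (simp add: norm_mult power2_eq_square)
  then show ?thesis
    using False by simp
qed

lemma sq_int_conjugate:
  fixes f :: "'a \<Rightarrow> 'k::base_field"
  assumes "f \<in> sq_int M"
  shows "(\<lambda>\<omega>. conjugate (f \<omega>)) \<in> sq_int M"
  using assms measurable_compose[OF _ borel_measurable_conjugate, of f M]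
  by (simp add: sq_int_def norm_conjugate)

lemma sq_int_const: "prob_space M \<Longrightarrow> (\<lambda>\<omega>. c) \<in> sq_int M"
  by (simp add: sq_int_def prob_space.finite_measure finite_measure.integrable_const)

lemma sq_int_diff:
  fixes f g :: "'a \<Rightarrow> 'k::base_field"
  assumes "f \<in> sq_int M" "g \<in> sq_int M"
  shows "(\<lambda>\<omega>. f \<omega> - g \<omega>) \<in> sq_int M"
  using sq_int_add[OF assms(1) sq_int_mult_const[OF assms(2), of "- 1"]] by simp

lemma integrable_mult_sq_int:
  fixes f g :: "'a \<Rightarrow> 'k::base_field"
  assumes "f \<in> sq_int M" "g \<in> sq_int M"
  shows "integrable M (\<lambda>\<omega>. f \<omega> * g \<omega>)"
proof -
  have [measurable]: "f \<in> borel_measurable M" "g \<in> borel_measurable M"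
    using assms by (auto simp: sq_int_def)
  have "norm (x * y) \<le> (norm x)\<^sup>2 + (norm y)\<^sup>2" for x y :: 'k
  proof -
    have "0 \<le> norm x * norm y"
      by simp
    then show ?thesis
      using sum_squares_bound[of "norm x" "norm y"] unfolding norm_mult by linarith
  qed
  then have bound: "AE \<omega> in M. norm (f \<omega> * g \<omega>) \<le> norm ((norm (f \<omega>))\<^sup>2 + (norm (g \<omega>))\<^sup>2)"
    by (intro AE_I2) (simp add: abs_of_nonneg)
  have "integrable M (\<lambda>\<omega>. (norm (f \<omega>))\<^sup>2 + (norm (g \<omega>))\<^sup>2)"
    using assms by (auto simp: sq_int_def)
  then show ?thesis
    by (rule Bochner_Integration.integrable_bound[OF _ _ bound]) measurable
qed

lemma integrable_sq_int:
  fixes f :: "'a \<Rightarrow> 'k::base_field"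
  assumes "prob_space M" "f \<in> sq_int M"
  shows "integrable M f"
  using integrable_mult_sq_int[OF assms(2) sq_int_const[OF assms(1), of 1]] by simp

lemma sq_int_inner_Basis:
  fixes f :: "'a \<Rightarrow> 'k::base_field"
  assumes "f \<in> sq_int M" "b \<in> Basis"
  shows "(\<lambda>\<omega>. f \<omega> \<bullet> b) \<in> sq_int M"
proof -
  have [measurable]: "f \<in> borel_measurable M"
    using assms by (auto simp: sq_int_def)
  have "integrable M (\<lambda>\<omega>. (f \<omega> \<bullet> b)\<^sup>2)"
  proof (rule Bochner_Integration.integrable_bound)
    show "integrable M (\<lambda>\<omega>. (norm (f \<omega>))\<^sup>2)"
      using assms by (simp add: sq_int_def)
    show "AE \<omega> in M. norm ((f \<omega> \<bullet> b)\<^sup>2) \<le> norm ((norm (f \<omega>))\<^sup>2)"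
      using power_mono[OF Basis_le_norm[OF assms(2)], of _ 2] by (auto intro!: AE_I2)
  qed measurable
  then show ?thesis
    by (simp add: sq_int_def)
qed

lemma sq_int_scaleR:
  fixes c :: "'k::base_field" and f :: "'a \<Rightarrow> real"
  assumes "f \<in> sq_int M"
  shows "(\<lambda>\<omega>. f \<omega> *\<^sub>R c) \<in> sq_int M"
  using assms by (auto simp: sq_int_def power_mult_distrib)

lemma sq_int_sum:
  fixes f :: "'i \<Rightarrow> 'a \<Rightarrow> 'k::base_field"
  assumes "\<And>i. i \<in> I \<Longrightarrow> f i \<in> sq_int M"
  shows "(\<lambda>\<omega>. \<Sum>i\<in>I. f i \<omega>) \<in> sq_int M"
  using assms
proof (induction I rule: infinite_finite_induct)
  case (insert i I)
  then show ?case
    using sq_int_add[of "f i" M "\<lambda>\<omega>. \<Sum>i\<in>I. f i \<omega>"] by simp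
qed (simp_all add: sq_int_def)

text \<open>The definiteness of the inner product, which makes orthogonal projections unique.\<close>

lemma AE_eq_0_if_integral_mult_conjugate_eq_0:
  fixes f :: "'a \<Rightarrow> 'k::base_field"
  assumes "f \<in> sq_int M" "(\<integral>\<omega>. f \<omega> * conjugate (f \<omega>) \<partial>M) = 0"
  shows "AE \<omega> in M. f \<omega> = 0"
proof -
  have int: "integrable M (\<lambda>\<omega>. (norm (f \<omega>))\<^sup>2)"
    using assms by (simp add: sq_int_def)
  have "(\<integral>\<omega>. (norm (f \<omega>))\<^sup>2 \<partial>M) *\<^sub>R (1 :: 'k) = 0"
    using assms(2) int by (simp add: mult_conjugate_self)
  then show ?thesis
    using integral_nonneg_eq_0_iff_AE[OF int] by simp
qed

section \<open>Conditional expectation over the base field\<close>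

lemma prob_space_sigma_finite_subalgebra:
  assumes "prob_space M" "subalgebra M A"
  shows "sigma_finite_subalgebra M A"
  by (intro finite_measure_subalgebra_is_sigma_finite finite_measure_subalgebra.intro
      finite_measure_subalgebra_axioms.intro prob_space.finite_measure assms)

lemma borel_measurable_cond_exp: "cond_exp M A f \<in> borel_measurable A"
  unfolding cond_exp_def[abs_def] by measurable

text \<open>Jensen's inequality for the square, applied to each coordinate.\<close>

lemma sq_int_cond_exp:
  fixes f :: "'a \<Rightarrow> 'k::base_field"
  assumes "prob_space M" "subalgebra M A" "f \<in> sq_int M"
  shows "cond_exp M A f \<in> sq_int M"
proof -
  interpret prob_space M by fact
  interpret sigma_finite_subalgebra M A
    using assms by (intro prob_space_sigma_finite_subalgebra)
  have "real_cond_exp M A (\<lambda>\<omega>. f \<omega> \<bullet> b) \<in> sq_int M" if "b \<in> Basis" for b :: 'k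
  proof -
    have sq: "(\<lambda>\<omega>. f \<omega> \<bullet> b) \<in> sq_int M"
      using assms(3) that by (rule sq_int_inner_Basis)
    have "integrable M (\<lambda>\<omega>. (real_cond_exp M A (\<lambda>\<omega>. f \<omega> \<bullet> b) \<omega>)\<^sup>2)"
    proof (rule integrable_convex_cond_exp[where I = UNIV and q = "\<lambda>x. x\<^sup>2"])
      show "integrable M (\<lambda>\<omega>. f \<omega> \<bullet> b)"
        using assms(1) sq by (rule integrable_sq_int)
      show "integrable M (\<lambda>\<omega>. (f \<omega> \<bullet> b)\<^sup>2)"
        using sq by (simp add: sq_int_def)
    qed (auto simp: convex_power2)
    then show ?thesis
      by (simp add: sq_int_def)
  qed
  then show ?thesis
    unfolding cond_exp_def[abs_def] by (intro sq_int_sum sq_int_scaleR)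
qed

text \<open>The residual \<open>f - cond_exp M A f\<close> is orthogonal to the marginal space. Both integrals expand
  bilinearly over pairs of basis vectors, and for each pair of coordinates the real case
  applies.\<close>

lemma integral_cond_exp_mult:
  fixes f w :: "'a \<Rightarrow> 'k::base_field"
  assumes "prob_space M" "subalgebra M A" "f \<in> sq_int M" "w \<in> sq_int M" "w \<in> borel_measurable A"
  shows "(\<integral>\<omega>. cond_exp M A f \<omega> * w \<omega> \<partial>M) = (\<integral>\<omega>. f \<omega> * w \<omega> \<partial>M)"
proof -
  interpret sigma_finite_subalgebra M A
    using assms by (intro prob_space_sigma_finite_subalgebra)
  have [measurable]: "f \<in> borel_measurable M" "w \<in> borel_measurable A"
    using assms by (auto simp: sq_int_def)
  define g where "g b = real_cond_exp M A (\<lambda>\<omega>. f \<omega> \<bullet> b)" for b :: 'k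
  have w: "w \<omega> = (\<Sum>c\<in>Basis. (w \<omega> \<bullet> c) *\<^sub>R c)" for \<omega>
    by (simp add: euclidean_representation)
  have expand: "(\<Sum>b\<in>Basis. x b *\<^sub>R b) * w \<omega> =
      (\<Sum>b\<in>Basis. \<Sum>c\<in>Basis. ((w \<omega> \<bullet> c) * x b) *\<^sub>R (b * c))" for x :: "'k \<Rightarrow> real" and \<omega>
    by (subst w) (simp add: sum_product mult.commute)
  have f: "f \<omega> * w \<omega> = (\<Sum>b\<in>Basis. \<Sum>c\<in>Basis. ((w \<omega> \<bullet> c) * (f \<omega> \<bullet> b)) *\<^sub>R (b * c))" for \<omega>
    using expand[of "\<lambda>b. f \<omega> \<bullet> b" \<omega>] by (simp add: euclidean_representation)
  have int: "integrable M (\<lambda>\<omega>. (w \<omega> \<bullet> c) * (f \<omega> \<bullet> b))" if "b \<in> Basis" "c \<in> Basis" for b c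
    using assms that by (intro integrable_mult_sq_int sq_int_inner_Basis)
  have coord: "integrable M (\<lambda>\<omega>. (w \<omega> \<bullet> c) * g b \<omega>)"
      "(\<integral>\<omega>. (w \<omega> \<bullet> c) * g b \<omega> \<partial>M) = (\<integral>\<omega>. (w \<omega> \<bullet> c) * (f \<omega> \<bullet> b) \<partial>M)"
    if "b \<in> Basis" "c \<in> Basis" for b c
    unfolding g_def by (rule real_cond_exp_intg; use int[OF that] in simp)+
  have "(\<integral>\<omega>. cond_exp M A f \<omega> * w \<omega> \<partial>M) =
      (\<integral>\<omega>. (\<Sum>b\<in>Basis. \<Sum>c\<in>Basis. ((w \<omega> \<bullet> c) * g b \<omega>) *\<^sub>R (b * c)) \<partial>M)"
    by (simp add: cond_exp_def expand flip: g_def)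
  also have "\<dots> = (\<Sum>b\<in>Basis. \<Sum>c\<in>Basis. (\<integral>\<omega>. (w \<omega> \<bullet> c) * g b \<omega> \<partial>M) *\<^sub>R (b * c))"
    by (simp add: Bochner_Integration.integral_sum coord(1))
  also have "\<dots> = (\<Sum>b\<in>Basis. \<Sum>c\<in>Basis. (\<integral>\<omega>. (w \<omega> \<bullet> c) * (f \<omega> \<bullet> b) \<partial>M) *\<^sub>R (b * c))"
    by (simp add: coord(2))
  also have "\<dots> = (\<integral>\<omega>. f \<omega> * w \<omega> \<partial>M)"
    by (simp add: f Bochner_Integration.integral_sum int)
  finally show ?thesis .
qed

lemma integral_cond_exp:
  fixes f :: "'a \<Rightarrow> 'k::base_field"
  assumes "prob_space M" "subalgebra M A" "f \<in> sq_int M"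
  shows "(\<integral>\<omega>. cond_exp M A f \<omega> \<partial>M) = (\<integral>\<omega>. f \<omega> \<partial>M)"
  using integral_cond_exp_mult[OF assms sq_int_const[OF assms(1), of 1]] by simp

lemma cond_exp_add_const:
  fixes f :: "'a \<Rightarrow> 'k::base_field"
  assumes "prob_space M" "subalgebra M A" "f \<in> sq_int M"
  shows "AE \<omega> in M. cond_exp M A (\<lambda>\<omega>. f \<omega> + c) \<omega> = cond_exp M A f \<omega> + c"
proof -
  interpret prob_space M by fact
  interpret sigma_finite_subalgebra M A
    using assms by (intro prob_space_sigma_finite_subalgebra)
  have "AE \<omega> in M. \<forall>b\<in>(Basis :: 'k set). real_cond_exp M A (\<lambda>\<omega>. (f \<omega> + c) \<bullet> b) \<omega> =
      real_cond_exp M A (\<lambda>\<omega>. f \<omega> \<bullet> b) \<omega> + c \<bullet> b"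
  proof (rule AE_finite_allI)
    fix b :: 'k assume "b \<in> Basis"
    then have "integrable M (\<lambda>\<omega>. f \<omega> \<bullet> b)"
      using assms by (intro integrable_sq_int sq_int_inner_Basis)
    then have "AE \<omega> in M. real_cond_exp M A (\<lambda>\<omega>. f \<omega> \<bullet> b + c \<bullet> b) \<omega> =
        real_cond_exp M A (\<lambda>\<omega>. f \<omega> \<bullet> b) \<omega> + real_cond_exp M A (\<lambda>\<omega>. c \<bullet> b) \<omega>"
      by (intro real_cond_exp_add) simp_all
    moreover have "AE \<omega> in M. real_cond_exp M A (\<lambda>\<omega>. c \<bullet> b) \<omega> = c \<bullet> b"
      by (rule real_cond_exp_F_meas) simp_all
    ultimately show "AE \<omega> in M. real_cond_exp M A (\<lambda>\<omega>. (f \<omega> + c) \<bullet> b) \<omega> =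
        real_cond_exp M A (\<lambda>\<omega>. f \<omega> \<bullet> b) \<omega> + c \<bullet> b"
      by eventually_elim (simp add: inner_add_left)
  qed simp
  then show ?thesis
  proof (rule AE_mp, intro AE_I2 impI)
    fix \<omega>
    assume "\<forall>b\<in>(Basis :: 'k set). real_cond_exp M A (\<lambda>\<omega>. (f \<omega> + c) \<bullet> b) \<omega> =
      real_cond_exp M A (\<lambda>\<omega>. f \<omega> \<bullet> b) \<omega> + c \<bullet> b"
    then show "cond_exp M A (\<lambda>\<omega>. f \<omega> + c) \<omega> = cond_exp M A f \<omega> + c"
      by (simp add: cond_exp_def scaleR_add_left sum.distrib euclidean_representation)
  qed
qed

section \<open>Projections onto centred marginal spaces\<close>

lemma ae_class_eq_iff:
  assumes "f \<in> sq_int M" "g \<in> sq_int M"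
  shows "ae_class M f = ae_class M g \<longleftrightarrow> (AE \<omega> in M. f \<omega> = g \<omega>)"
  using assms ae_class_eqI[OF assms] mem_ae_class[of g M f] mem_ae_class[of g M g] by auto

lemma vdiff_L2:
  assumes "f \<in> sq_int M" "g \<in> sq_int M"
  shows "vdiff (L2 M) (ae_class M f) (ae_class M g) = ae_class M (\<lambda>\<omega>. f \<omega> - g \<omega>)"
  using assms vadd_L2[OF assms(1) sq_int_mult_const[OF assms(2), of "- 1"]]
  by (simp add: vdiff_def vscale_L2)

text \<open>The representative selected by \<open>rep\<close> need not be \<open>A\<close>-measurable; this form gives access to one
  that is.\<close>

lemma L2_0_eq:
  "(L2_0 M A :: ('a \<Rightarrow> 'k::base_field) set set) =
    ae_class M ` {f \<in> sq_int M. f \<in> borel_measurable A \<and> (\<integral>\<omega>. f \<omega> \<partial>M) = 0}"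
    (is "?L = ?R")
proof
  show "?L \<subseteq> ?R"
  proof
    fix X assume "X \<in> ?L"
    then obtain g h where g: "g \<in> sq_int M" "X = ae_class M g"
      and h: "h \<in> X" "h \<in> borel_measurable A" and 0: "(\<integral>\<omega>. rep X \<omega> \<partial>M) = 0"
      by (auto simp: L2_0_def L2_sub_def vecs_L2)
    then have "h \<in> sq_int M" "ae_class M h = X"
      using ae_class_eq_iff[of g M h] by (auto simp: mem_ae_class)
    then show "X \<in> ?R"
      using h 0 integral_rep_ae_class[of h M] by auto
  qed
  show "?R \<subseteq> ?L"
  proof
    fix X assume "X \<in> ?R"
    then obtain f where f: "f \<in> sq_int M" "f \<in> borel_measurable A" "(\<integral>\<omega>. f \<omega> \<partial>M) = 0"
      and X: "X = ae_class M f"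
      by auto
    have "f \<in> ae_class M f"
      using f by (simp add: mem_ae_class)
    then show "X \<in> ?L"
      using f by (auto simp: L2_0_def L2_sub_def vecs_L2 X integral_rep_ae_class)
  qed
qed

text \<open>Two solutions of the defining condition of the projection differ by an element of the centred
  marginal space that is orthogonal to itself.\<close>

lemma proj_L2_0_eqI:
  fixes f g :: "'a \<Rightarrow> 'k::base_field"
  assumes M: "prob_space M" "subalgebra M A" and f: "f \<in> sq_int M"
    and g: "g \<in> sq_int M" "g \<in> borel_measurable A" "(\<integral>\<omega>. g \<omega> \<partial>M) = 0"
    and orth: "\<And>h. h \<in> sq_int M \<Longrightarrow> h \<in> borel_measurable A \<Longrightarrow> (\<integral>\<omega>. h \<omega> \<partial>M) = 0 \<Longrightarrow>
      (\<integral>\<omega>. (f \<omega> - g \<omega>) * conjugate (h \<omega>) \<partial>M) = 0"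
  shows "proj (L2 M) (L2_0 M A) (ae_class M f) = ae_class M g"
  unfolding proj_def
proof (rule the_equality)
  show "ae_class M g \<in> L2_0 M A \<and>
      (\<forall>Z\<in>L2_0 M A. vinner (L2 M) (vdiff (L2 M) (ae_class M f) (ae_class M g)) Z = 0)"
    using f g orth by (auto simp: L2_0_eq vdiff_L2 vinner_L2 sq_int_diff)
next
  fix Y
  assume Y: "Y \<in> L2_0 M A \<and>
      (\<forall>Z\<in>L2_0 M A. vinner (L2 M) (vdiff (L2 M) (ae_class M f) Y) Z = 0)"
  then obtain h where h: "h \<in> sq_int M" "h \<in> borel_measurable A" "(\<integral>\<omega>. h \<omega> \<partial>M) = 0"
    and Yh: "Y = ae_class M h"
    by (auto simp: L2_0_eq)
  define d where "d \<omega> = h \<omega> - g \<omega>" for \<omega>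
  have d: "d \<in> sq_int M" "d \<in> borel_measurable A" "(\<integral>\<omega>. d \<omega> \<partial>M) = 0"
    using g h by (auto simp: d_def[abs_def] sq_int_diff integrable_sq_int[OF M(1)])
  then have "ae_class M d \<in> L2_0 M A"
    by (auto simp: L2_0_eq)
  then have "(\<integral>\<omega>. (f \<omega> - h \<omega>) * conjugate (d \<omega>) \<partial>M) = 0"
    using Y f h d by (auto simp: Yh vdiff_L2 vinner_L2 sq_int_diff)
  moreover have "(\<integral>\<omega>. (f \<omega> - g \<omega>) * conjugate (d \<omega>) \<partial>M) = 0"
    using d by (rule orth)
  moreover have "(\<integral>\<omega>. d \<omega> * conjugate (d \<omega>) \<partial>M) =
      (\<integral>\<omega>. (f \<omega> - g \<omega>) * conjugate (d \<omega>) - (f \<omega> - h \<omega>) * conjugate (d \<omega>) \<partial>M)"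
    by (simp add: d_def algebra_simps)
  moreover have "\<dots> = (\<integral>\<omega>. (f \<omega> - g \<omega>) * conjugate (d \<omega>) \<partial>M) -
      (\<integral>\<omega>. (f \<omega> - h \<omega>) * conjugate (d \<omega>) \<partial>M)"
    using f g h d
    by (intro Bochner_Integration.integral_diff integrable_mult_sq_int sq_int_diff sq_int_conjugate)
  ultimately have "(\<integral>\<omega>. d \<omega> * conjugate (d \<omega>) \<partial>M) = 0"
    by simp
  with d(1) have "AE \<omega> in M. d \<omega> = 0"
    by (rule AE_eq_0_if_integral_mult_conjugate_eq_0)
  then show "Y = ae_class M g"
    using g h by (auto simp: Yh ae_class_eq_iff d_def)
qed

text \<open>This identity carries the theorem. Subtracting the mean puts the conditional expectation into
  the centred space without spoiling orthogonality, since a constant is orthogonal to every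
  centred random variable.\<close>

lemma proj_L2_0:
  fixes f :: "'a \<Rightarrow> 'k::base_field"
  assumes M: "prob_space M" "subalgebra M A" and f: "f \<in> sq_int M"
  shows "proj (L2 M) (L2_0 M A) (ae_class M f) =
    ae_class M (\<lambda>\<omega>. cond_exp M A f \<omega> - (\<integral>\<omega>. f \<omega> \<partial>M))"
    (is "_ = ae_class M (\<lambda>\<omega>. _ - ?m)")
proof (rule proj_L2_0_eqI[OF assms])
  interpret prob_space M by fact
  note ce = sq_int_cond_exp[OF assms] and [measurable] = borel_measurable_cond_exp[of M A f]
  show "(\<lambda>\<omega>. cond_exp M A f \<omega> - ?m) \<in> sq_int M"
    using ce sq_int_const[OF M(1)] by (rule sq_int_diff)
  show "(\<lambda>\<omega>. cond_exp M A f \<omega> - ?m) \<in> borel_measurable A"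
    by measurable
  show "(\<integral>\<omega>. cond_exp M A f \<omega> - ?m \<partial>M) = 0"
    using integrable_sq_int[OF M(1) ce] by (simp add: integral_cond_exp[OF assms] prob_space)
  fix h :: "'a \<Rightarrow> 'k"
  assume h: "h \<in> sq_int M" "h \<in> borel_measurable A" "(\<integral>\<omega>. h \<omega> \<partial>M) = 0"
  let ?h = "\<lambda>\<omega>. conjugate (h \<omega>)"
  have h': "?h \<in> sq_int M" "?h \<in> borel_measurable A"
    using sq_int_conjugate[OF h(1)] measurable_compose[OF h(2) borel_measurable_conjugate] by auto
  have "bounded_linear (conjugate :: 'k \<Rightarrow> 'k)"
    unfolding linear_conv_bounded_linear[symmetric]
    by (intro linearI) (simp_all add: conjugate_add conjugate_scaleR)
  then have "(\<integral>\<omega>. ?h \<omega> \<partial>M) = conjugate (\<integral>\<omega>. h \<omega> \<partial>M)"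
    using integrable_sq_int[OF M(1) h(1)] by (rule integral_bounded_linear)
  also have "\<dots> = 0"
    using norm_conjugate[of "0 :: 'k"] by (simp add: h(3))
  finally have 0: "(\<integral>\<omega>. ?h \<omega> \<partial>M) = 0" .
  have "(\<integral>\<omega>. (f \<omega> - (cond_exp M A f \<omega> - ?m)) * ?h \<omega> \<partial>M) =
      (\<integral>\<omega>. f \<omega> * ?h \<omega> - cond_exp M A f \<omega> * ?h \<omega> + ?m * ?h \<omega> \<partial>M)"
    by (simp add: algebra_simps)
  also have "\<dots> = (\<integral>\<omega>. f \<omega> * ?h \<omega> \<partial>M) - (\<integral>\<omega>. cond_exp M A f \<omega> * ?h \<omega> \<partial>M) + ?m * (\<integral>\<omega>. ?h \<omega> \<partial>M)"
    using integrable_mult_sq_int[OF f h'(1)] integrable_mult_sq_int[OF ce h'(1)]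
      integrable_sq_int[OF M(1) h'(1)]
    by simp
  also have "\<dots> = 0"
    using integral_cond_exp_mult[OF assms h'] 0 by simp
  finally show "(\<integral>\<omega>. (f \<omega> - (cond_exp M A f \<omega> - ?m)) * ?h \<omega> \<partial>M) = 0" .
qed

section \<open>Equivalence of the two inverse properties\<close>

lemma IMP_imp_IBAP:
  fixes M :: "'a measure" and F :: "nat \<Rightarrow> 'a measure"
  assumes M: "prob_space M" and sub: "\<And>k. k \<in> {1..n} \<Longrightarrow> subalgebra M (F k)"
    and IMP: "IMP TYPE('k::base_field) M F n"
  shows "IBAP (L2 M :: (('a \<Rightarrow> 'k) set, 'k) inner_space) (\<lambda>k. L2_0 M (F k)) n"
  unfolding IBAP_def
proof (intro allI impI)
  fix X :: "nat \<Rightarrow> ('a \<Rightarrow> 'k) set"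
  assume "\<forall>k\<in>{1..n}. X k \<in> L2_0 M (F k)"
  then have "\<forall>k\<in>{1..n}. \<exists>f. X k = ae_class M f \<and> f \<in> sq_int M \<and> f \<in> borel_measurable (F k) \<and>
      (\<integral>\<omega>. f \<omega> \<partial>M) = 0"
    by (fastforce simp: L2_0_eq)
  then obtain \<xi> where \<xi>: "\<And>k. k \<in> {1..n} \<Longrightarrow> X k = ae_class M (\<xi> k) \<and> \<xi> k \<in> sq_int M \<and>
      \<xi> k \<in> borel_measurable (F k) \<and> (\<integral>\<omega>. \<xi> k \<omega> \<partial>M) = 0"
    by metis
  then obtain \<eta> where \<eta>: "\<eta> \<in> sq_int M"
    and ce: "\<And>k. k \<in> {1..n} \<Longrightarrow> AE \<omega> in M. cond_exp M (F k) \<eta> \<omega> = \<xi> k \<omega>"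
    using IMP[unfolded IMP_def, rule_format, of \<xi>] by (auto simp: sq_int_def)
  have "proj (L2 M) (L2_0 M (F k)) (ae_class M \<eta>) = X k" if k: "k \<in> {1..n}" for k
  proof -
    note ck = sq_int_cond_exp[OF M sub[OF k] \<eta>]
    have "(\<integral>\<omega>. \<eta> \<omega> \<partial>M) = (\<integral>\<omega>. cond_exp M (F k) \<eta> \<omega> \<partial>M)"
      using integral_cond_exp[OF M sub[OF k] \<eta>] by simp
    also have "\<dots> = (\<integral>\<omega>. \<xi> k \<omega> \<partial>M)"
      using ck \<xi>[OF k] ce[OF k] by (intro integral_cong_AE) (auto simp: sq_int_def)
    also have "\<dots> = 0"
      using \<xi>[OF k] by simp
    finally have "proj (L2 M) (L2_0 M (F k)) (ae_class M \<eta>) = ae_class M (cond_exp M (F k) \<eta>)"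
      by (simp add: proj_L2_0[OF M sub[OF k] \<eta>])
    also have "\<dots> = X k"
      using ck \<xi>[OF k] ce[OF k] by (simp add: ae_class_eq_iff)
    finally show ?thesis .
  qed
  then show "\<exists>Y\<in>vecs (L2 M). \<forall>k\<in>{1..n}. proj (L2 M) (L2_0 M (F k)) Y = X k"
    using \<eta> unfolding vecs_L2 by blast
qed

lemma IBAP_imp_IMP:
  fixes M :: "'a measure" and F :: "nat \<Rightarrow> 'a measure"
  assumes M: "prob_space M" and sub: "\<And>k. k \<in> {1..n} \<Longrightarrow> subalgebra M (F k)"
    and IBAP: "IBAP (L2 M :: (('a \<Rightarrow> 'k::base_field) set, 'k) inner_space) (\<lambda>k. L2_0 M (F k)) n"
  shows "IMP TYPE('k) M F n"
  unfolding IMP_def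
proof (intro allI impI)
  interpret prob_space M by fact
  fix \<xi> :: "nat \<Rightarrow> 'a \<Rightarrow> 'k"
  assume asm: "(\<forall>k\<in>{1..n}. \<xi> k \<in> borel_measurable (F k) \<and> integrable M (\<lambda>\<omega>. (norm (\<xi> k \<omega>))\<^sup>2)) \<and>
    (\<forall>j\<in>{1..n}. \<forall>k\<in>{1..n}. (\<integral>\<omega>. \<xi> j \<omega> \<partial>M) = (\<integral>\<omega>. \<xi> k \<omega> \<partial>M))"
  define c where "c = (\<integral>\<omega>. \<xi> 1 \<omega> \<partial>M)"
  have \<xi>: "\<xi> k \<in> sq_int M" "\<xi> k \<in> borel_measurable (F k)" "(\<integral>\<omega>. \<xi> k \<omega> \<partial>M) = c"
    if k: "k \<in> {1..n}" for k
  proof -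
    have "1 \<in> {1..n}"
      using k by simp
    then show "(\<integral>\<omega>. \<xi> k \<omega> \<partial>M) = c"
      using asm k unfolding c_def by blast
    show "\<xi> k \<in> borel_measurable (F k)"
      using asm k by blast
    then show "\<xi> k \<in> sq_int M"
      using asm k measurable_from_subalg[OF sub[OF k]] unfolding sq_int_def by blast
  qed
  have \<xi>c: "(\<lambda>\<omega>. \<xi> k \<omega> - c) \<in> sq_int M" if "k \<in> {1..n}" for k
    using \<xi>(1)[OF that] sq_int_const[OF M] by (rule sq_int_diff)
  have "ae_class M (\<lambda>\<omega>. \<xi> k \<omega> - c) \<in> L2_0 M (F k)" if k: "k \<in> {1..n}" for k
    unfolding L2_0_eq
    using \<xi>[OF k] \<xi>c[OF k] integrable_sq_int[OF M \<xi>(1)[OF k]] by (intro imageI) (simp add: prob_space)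
  then obtain f where f: "f \<in> sq_int M"
    and proj: "\<And>k. k \<in> {1..n} \<Longrightarrow>
      proj (L2 M) (L2_0 M (F k)) (ae_class M f) = ae_class M (\<lambda>\<omega>. \<xi> k \<omega> - c)"
    using IBAP[unfolded IBAP_def, rule_format, of "\<lambda>k. ae_class M (\<lambda>\<omega>. \<xi> k \<omega> - c)"]
    by (auto simp: vecs_L2)
  \<comment> \<open>The projections of \<open>f\<close> do not determine its mean \<open>m\<close>, so it has to be moved to \<open>c\<close>.\<close>
  define m where "m = (\<integral>\<omega>. f \<omega> \<partial>M)"
  define \<eta> where "\<eta> = (\<lambda>\<omega>. f \<omega> + (c - m))"
  have "\<eta> \<in> sq_int M"
    unfolding \<eta>_def using f sq_int_const[OF M] by (rule sq_int_add)
  moreover have "AE \<omega> in M. cond_exp M (F k) \<eta> \<omega> = \<xi> k \<omega>" if k: "k \<in> {1..n}" for k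
  proof -
    have "(\<lambda>\<omega>. cond_exp M (F k) f \<omega> - m) \<in> sq_int M"
      using sq_int_cond_exp[OF M sub[OF k] f] sq_int_const[OF M] by (rule sq_int_diff)
    then have "AE \<omega> in M. cond_exp M (F k) f \<omega> - m = \<xi> k \<omega> - c"
      using proj[OF k] \<xi>c[OF k] by (simp add: proj_L2_0[OF M sub[OF k] f] ae_class_eq_iff m_def)
    then show ?thesis
      using cond_exp_add_const[OF M sub[OF k] f, of "c - m"]
      unfolding \<eta>_def by eventually_elim (simp add: algebra_simps)
  qed
  ultimately show "\<exists>\<eta>. \<eta> \<in> borel_measurable M \<and> integrable M (\<lambda>\<omega>. (norm (\<eta> \<omega>))\<^sup>2) \<and>
      (\<forall>k\<in>{1..n}. AE \<omega> in M. cond_exp M (F k) \<eta> \<omega> = \<xi> k \<omega>)"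
    by (auto simp: sq_int_def)
qed

lemma IMP_iff_IBAP:
  fixes M :: "'a measure" and F :: "nat \<Rightarrow> 'a measure"
  assumes M: "prob_space M" and sub: "\<And>k. k \<in> {1..n} \<Longrightarrow> subalgebra M (F k)"
  shows "IMP TYPE('k::base_field) M F n \<longleftrightarrow>
    IBAP (L2 M :: (('a \<Rightarrow> 'k) set, 'k) inner_space) (\<lambda>k. L2_0 M (F k)) n"
proof
  assume "IMP TYPE('k) M F n"
  with M sub show "IBAP (L2 M :: (('a \<Rightarrow> 'k) set, 'k) inner_space) (\<lambda>k. L2_0 M (F k)) n"
    by (rule IMP_imp_IBAP)
next
  assume "IBAP (L2 M :: (('a \<Rightarrow> 'k) set, 'k) inner_space) (\<lambda>k. L2_0 M (F k)) n"
  with M sub show "IMP TYPE('k) M F n"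
    by (rule IBAP_imp_IMP)
qed

theorem theorem5p1:
  fixes M :: "'a measure" and F :: "nat \<Rightarrow> 'a measure" and n :: nat
  assumes "prob_space M"
    and "\<And>k. k \<in> {1..n} \<Longrightarrow> subalgebra M (F k)"
  shows "(IMP TYPE(real) M F n \<longleftrightarrow>
            IBAP (L2 M :: (('a \<Rightarrow> real) set, real) inner_space) (\<lambda>k. L2_0 M (F k)) n) \<and>
         (IMP TYPE(complex) M F n \<longleftrightarrow>
            IBAP (L2 M :: (('a \<Rightarrow> complex) set, complex) inner_space) (\<lambda>k. L2_0 M (F k)) n)"
proof (intro conjI)
  show "IMP TYPE(real) M F n \<longleftrightarrow>
      IBAP (L2 M :: (('a \<Rightarrow> real) set, real) inner_space) (\<lambda>k. L2_0 M (F k)) n"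
    using assms by (rule IMP_iff_IBAP)
  show "IMP TYPE(complex) M F n \<longleftrightarrow>
      IBAP (L2 M :: (('a \<Rightarrow> complex) set, complex) inner_space) (\<lambda>k. L2_0 M (F k)) n"
    using assms by (rule IMP_iff_IBAP)
qed

end
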